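(* Let $\Omega$ be an infinite set and let $G$ be a subgroup of $\mathrm{Sym}(\Omega)$ such that every infinite normal subgroup of $G$ is transitive on $\Omega$. Let $p$ be a prime number and suppose that $G$ has a normal subgroup $M$ that acts regularly on $\Omega$ and is a divisible abelian $p$-group of finite rank $r$. Let $\alpha\in\Omega$, and suppose that the stabiliser $H:=G_\alpha$ is finite and acts faithfully on $M$ by conjugation. Let $V:=M[p]=\{x\in M\mid x^p=1\}$, regarded as an $\mathbb F_pH$-module of dimension $r$ via the conjugation action of $H$. If $p>2$ then $H$ acts faithfully on $V$. If $p=2$ then the kernel $K$ of the action of $H$ on $V$ is an elementary abelian $2$-group.
   Context: A permutation group acts regularly if it is transitive with trivial point stabilisers. A divisible abelian $p$-group of finite rank $r$ is isomorphic to a direct sum of $r$ copies of the Prüfer $p$-group $C_{p^\infty}$. The trivial group counts as an elementary abelian $2$-group. *)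

theory Defs
  imports
    Complex_Main
    "HOL-Algebra.Group_Action"
    "HOL-Algebra.Product_Groups"
    "HOL-Algebra.Module"
    "HOL-Number_Theory.Residues"
begin

text \<open>
  Permutation groups on \<open>\<Omega>\<close> are subgroups of the library's \<open>BijGroup \<Omega>\<close>, whose elements are the
  bijections of \<open>\<Omega>\<close> (extensional outside \<open>\<Omega>\<close>) and whose product is composition. Such a group
  acts on \<open>\<Omega>\<close> through \<open>\<lambda>g. g\<close>.
\<close>

abbreviation perm_group :: "'a set \<Rightarrow> ('a \<Rightarrow> 'a) set \<Rightarrow> ('a \<Rightarrow> 'a) monoid"
  where "perm_group \<Omega> G \<equiv> (BijGroup \<Omega>)\<lparr>carrier := G\<rparr>"

locale regular_action = transitive_action +
  assumes trivial_stabilizer: "x \<in> E \<Longrightarrow> stabilizer G \<phi> x = {\<one>}"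

definition conj_action :: "('a, 'c) monoid_scheme \<Rightarrow> 'a set \<Rightarrow> 'a \<Rightarrow> 'a \<Rightarrow> 'a"
  where "conj_action G X = (\<lambda>g. \<lambda>x\<in>X. g \<otimes>\<^bsub>G\<^esub> x \<otimes>\<^bsub>G\<^esub> inv\<^bsub>G\<^esub> g)"

text \<open>The Pruefer group, realised as the group of complex roots of unity of \<open>p\<close>-power order.\<close>

definition pruefer_group :: "nat \<Rightarrow> complex monoid"
  where "pruefer_group p =
    \<lparr>carrier = {z. \<exists>n::nat. z ^ (p ^ n) = 1}, monoid.mult = (*), one = 1\<rparr>"

text \<open>
  The last conjunct says that the rank is \<open>r\<close>. By itself it implies the first three, which spell
  out the words ``abelian'', ``\<open>p\<close>-group'' and ``divisible''.
\<close>

definition divisible_abelian_p_group_of_rank :: "nat \<Rightarrow> nat \<Rightarrow> ('a, 'c) monoid_scheme \<Rightarrow> bool"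
  where "divisible_abelian_p_group_of_rank p r A \<longleftrightarrow>
    comm_group A \<and>
    (\<forall>x\<in>carrier A. \<exists>n::nat. x [^]\<^bsub>A\<^esub> (p ^ n) = \<one>\<^bsub>A\<^esub>) \<and>
    (\<forall>x\<in>carrier A. \<forall>n::nat. 0 < n \<longrightarrow> (\<exists>y\<in>carrier A. y [^]\<^bsub>A\<^esub> n = x)) \<and>
    A \<cong> sum_group {..<r} (\<lambda>_. pruefer_group p)"

text \<open>The trivial group is allowed.\<close>

definition elementary_abelian :: "nat \<Rightarrow> ('a, 'c) monoid_scheme \<Rightarrow> bool"
  where "elementary_abelian p A \<longleftrightarrow>
    comm_group A \<and> (\<forall>x\<in>carrier A. x [^]\<^bsub>A\<^esub> p = \<one>\<^bsub>A\<^esub>)"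

definition p_torsion :: "('a, 'c) monoid_scheme \<Rightarrow> nat \<Rightarrow> 'a set"
  where "p_torsion A p = {x \<in> carrier A. x [^]\<^bsub>A\<^esub> p = \<one>\<^bsub>A\<^esub>}"

text \<open>
  \<open>A[p]\<close> written additively as a module over \<open>residue_ring p\<close>: addition is the product of \<open>A\<close>, and
  the scalar \<open>k\<close> acts as the \<open>k\<close>-th power. The library's module record extends the ring record, but
  the fields \<open>mult\<close> and \<open>one\<close> play no role for modules.
\<close>

definition p_torsion_module :: "('a, 'c) monoid_scheme \<Rightarrow> nat \<Rightarrow> (int, 'a) module"
  where "p_torsion_module A p =
    \<lparr>carrier = p_torsion A p, monoid.mult = undefined, one = undefined,
     zero = \<one>\<^bsub>A\<^esub>, add = (\<lambda>x y. x \<otimes>\<^bsub>A\<^esub> y), smult = (\<lambda>k x. x [^]\<^bsub>A\<^esub> k)\<rparr>"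

text \<open>\<open>V\<close> is an \<open>RH\<close>-module, the group \<open>H\<close> acting \<open>R\<close>-linearly through \<open>\<phi>\<close>.\<close>

definition group_module ::
  "('r, 'm) ring_scheme \<Rightarrow> ('h, 'k) monoid_scheme \<Rightarrow> ('r, 'v, 'n) module_scheme
    \<Rightarrow> ('h \<Rightarrow> 'v \<Rightarrow> 'v) \<Rightarrow> bool"
  where "group_module R H V \<phi> \<longleftrightarrow>
    module R V \<and> group_action H (carrier V) \<phi> \<and>
    (\<forall>h\<in>carrier H. \<forall>x\<in>carrier V. \<forall>y\<in>carrier V. \<phi> h (x \<oplus>\<^bsub>V\<^esub> y) = \<phi> h x \<oplus>\<^bsub>V\<^esub> \<phi> h y) \<and>
    (\<forall>h\<in>carrier H. \<forall>k\<in>carrier R. \<forall>x\<in>carrier V. \<phi> h (k \<odot>\<^bsub>V\<^esub> x) = k \<odot>\<^bsub>V\<^esub> \<phi> h x)"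

definition module_basis ::
  "('r, 'm) ring_scheme \<Rightarrow> ('r, 'v, 'n) module_scheme \<Rightarrow> 'v set \<Rightarrow> bool"
  where "module_basis R V B \<longleftrightarrow>
    B \<subseteq> carrier V \<and> finite B \<and>
    (\<forall>v\<in>carrier V. \<exists>!c. c \<in> B \<rightarrow>\<^sub>E carrier R \<and> v = (\<Oplus>\<^bsub>V\<^esub>b\<in>B. c b \<odot>\<^bsub>V\<^esub> b))"

definition has_dimension ::
  "('r, 'm) ring_scheme \<Rightarrow> ('r, 'v, 'n) module_scheme \<Rightarrow> nat \<Rightarrow> bool"
  where "has_dimension R V d \<longleftrightarrow> (\<exists>B. module_basis R V B \<and> card B = d)"

end

theory Submission
  imports Defs
begin

text \<open>
  Let \<open>h \<in> H\<close> act on the divisible abelian \<open>p\<close>-group \<open>M\<close> and put \<open>d x = h x \<cdot> x\<^sup>-\<^sup>1\<close>.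
  If \<open>h\<close> fixes \<open>M[p\<^sup>n]\<close> pointwise, where \<open>n \<ge> 1\<close>, then \<open>d\<close> maps \<open>M[p\<^bsup>n+k\<^esup>]\<close> into \<open>M[p\<^sup>k]\<close>.
  On \<open>M[p\<^bsup>n+2\<^esup>]\<close> the endomorphism \<open>d\<^sup>3\<close> is therefore trivial, and
  \<open>h\<^sup>p x = x \<cdot> (d x)\<^sup>p \<cdot> (d\<^sup>2 x)\<^bsup>p(p-1)/2\<^esup>\<close>, where the last factor vanishes if \<open>p\<close> is odd or \<open>n \<ge> 2\<close>.
  If moreover \<open>h\<^sup>p = 1\<close>, then \<open>d (x\<^sup>p) = (d x)\<^sup>p = 1\<close>, and as every element of \<open>M[p\<^bsup>n+1\<^esup>]\<close> is such an
  \<open>x\<^sup>p\<close>, \<open>h\<close> fixes \<open>M[p\<^bsup>n+1\<^esup>]\<close>. If instead \<open>h\<^sup>q = 1\<close> for a prime \<open>q \<noteq> p\<close>, then on \<open>M[p\<^bsup>n+1\<^esup>]\<close> the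
  element \<open>d x\<close> is killed by \<open>p\<close> and by \<open>q\<close>. Induction on \<open>n\<close> and on the order of \<open>h\<close> shows that an
  element of finite order fixing \<open>M[p]\<close> (for \<open>p\<close> odd) or \<open>M[4]\<close> (for \<open>p = 2\<close>) acts trivially on \<open>M\<close>.
  For \<open>p = 2\<close>, if \<open>h\<close> fixes \<open>M[2]\<close> then \<open>h\<^sup>2\<close> fixes \<open>M[4]\<close>, so that \<open>h\<^sup>2 = 1\<close>.
\<close>

section \<open>Iterates of an endomorphism in terms of its displacement\<close>

text \<open>Written additively, \<open>h = 1 + d\<close>, and this is the binomial expansion of
  \<open>(1 + d)^n\<close> at \<open>x\<close>, cut off after the quadratic term because the third
  power of \<open>d\<close> kills \<open>x\<close>. In the induction step \<open>h\<close>
  multiplies \<open>x\<close> by \<open>d x\<close>, multiplies \<open>d x\<close> by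
  \<open>d (d x)\<close> and fixes \<open>d (d x)\<close>; the exponents then combine by Pascal's
  rule.\<close>

lemma (in comm_group) funpow_eq_displacement:
  assumes h: "h \<in> hom G G" and d_def: "d = (\<lambda>y. h y \<otimes> inv y)"
    and x: "x \<in> carrier G" and ddd: "d (d (d x)) = \<one>"
  shows "(h ^^ n) x = x \<otimes> d x [^] n \<otimes> d (d x) [^] (n choose 2)"
proof (induction n)
  case 0
  then show ?case using x by (simp add: numeral_2_eq_2)
next
  case (Suc n)
  have hc: "h y \<in> carrier G" if "y \<in> carrier G" for y
    using h that by (auto simp: hom_def)
  have dc: "d y \<in> carrier G" if "y \<in> carrier G" for y
    using hc that by (simp add: d_def)
  have hd: "h y = y \<otimes> d y" if "y \<in> carrier G" for y
    using that hc[OF that] by (simp add: d_def m_lcomm[of y "h y"])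
  interpret h: group_hom G G h
    using h by unfold_locales
  have c: "d x \<in> carrier G" "d (d x) \<in> carrier G"
    using dc x by auto
  have hddx: "h (d (d x)) = d (d x)"
    using hd[OF c(2)] ddd c by simp
  have "(h ^^ Suc n) x = h x \<otimes> h (d x) [^] n \<otimes> h (d (d x)) [^] (n choose 2)"
    using x c by (simp add: Suc.IH h.hom_nat_pow)
  also have "\<dots> = x \<otimes> d x \<otimes> (d x \<otimes> d (d x)) [^] n \<otimes> d (d x) [^] (n choose 2)"
    using hd x c hddx by simp
  also have "\<dots> = x \<otimes> d x [^] Suc n \<otimes> d (d x) [^] (n + (n choose 2))"
    using x c by (simp add: nat_pow_distrib nat_pow_mult[symmetric] m_ac)
  also have "n + (n choose 2) = Suc n choose 2"
    by (simp add: numeral_2_eq_2)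
  finally show ?case .
qed

section \<open>Endomorphisms of finite order on the layers of \<open>p\<close>-power torsion\<close>

lemma (in monoid) p_torsion_mono:
  assumes "m dvd n"
  shows "p_torsion G m \<subseteq> p_torsion G n"
proof -
  obtain k where "n = m * k"
    using assms by blast
  then show ?thesis
    by (auto simp: p_torsion_def nat_pow_pow[symmetric])
qed

lemma (in group) pow_coprime_eq_one:
  fixes m n :: nat
  assumes "x \<in> carrier G" "x [^] m = \<one>" "x [^] n = \<one>" "coprime m n"
  shows "x = \<one>"
  using assms by (metis pow_eq_id coprime_common_divisor_nat nat_dvd_1_iff_1 nat_pow_eone)

text \<open>One step up the layers. The bound on \<open>n\<close> for \<open>p = 2\<close> excludes
  inversion: its square is the identity and it fixes every element of order 2, but it moves every
  element of order 4.\<close>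

lemma (in comm_group) hom_fixes_p_torsion_Suc:
  fixes p q n :: nat
  assumes h: "h \<in> hom G G" and p: "prime p" and q: "prime q"
    and div: "\<And>x. x \<in> carrier G \<Longrightarrow> \<exists>y\<in>carrier G. y [^] p = x"
    and hq: "\<And>x. x \<in> carrier G \<Longrightarrow> (h ^^ q) x = x"
    and n: "1 \<le> n" "p = 2 \<Longrightarrow> 2 \<le> n"
    and fix_n: "\<And>x. x \<in> p_torsion G (p ^ n) \<Longrightarrow> h x = x"
    and y: "y \<in> p_torsion G (p ^ Suc n)"
  shows "h y = y"
proof -
  interpret h: group_hom G G h
    using h by unfold_locales
  define d where "d = (\<lambda>y. h y \<otimes> inv y)"
  have dc: "d x \<in> carrier G" if "x \<in> carrier G" for x
    using that by (simp add: d_def)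
  have d_pow: "d (x [^] k) = d x [^] k" if "x \<in> carrier G" for x and k :: nat
    using that by (simp add: d_def h.hom_nat_pow nat_pow_distrib nat_pow_inv)
  have d1: "d x = \<one> \<longleftrightarrow> h x = x" if "x \<in> carrier G" for x
    using that by (simp add: d_def) (metis h.hom_closed inv_closed inv_inv inv_equality r_inv)
  have d_fix: "d x = \<one>" if "x \<in> p_torsion G (p ^ n)" for x
    using that fix_n d1 by (auto simp: p_torsion_def)
  \<comment> \<open>\<open>d\<close> commutes with powers, and it kills
    \<open>x [^] (p ^ k)\<close>, which lies in the layer fixed by \<open>h\<close>.\<close>
  have d_tors: "d x \<in> p_torsion G (p ^ k)" if "x \<in> p_torsion G (p ^ (n + k))" for x k
  proof -
    have x: "x \<in> carrier G" "x [^] (p ^ (n + k)) = \<one>"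
      using that by (auto simp: p_torsion_def)
    have "x [^] (p ^ k) \<in> p_torsion G (p ^ n)"
      using x by (simp add: p_torsion_def nat_pow_pow power_add mult.commute)
    from d_fix[OF this] show ?thesis
      using x dc by (simp add: d_pow p_torsion_def)
  qed
  have fix_k: "d x = \<one>" if "x \<in> p_torsion G (p ^ k)" "k \<le> n" for x k
    using d_fix p_torsion_mono[of "p ^ k" "p ^ n"] that by (auto simp: le_imp_power_dvd)
  have yc: "y \<in> carrier G"
    using y by (simp add: p_torsion_def)
  have dy: "d y \<in> p_torsion G p"
    using d_tors[of y 1] y by simp
  have ddy: "d (d y) = \<one>"
    using fix_k[of "d y" 1] dy n by simp
  have "d y = \<one>"
  proof (cases "q = p")
    case False
    have "d (d (d y)) = \<one>"
      using ddy by (simp add: d_def)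
    \<comment> \<open>Since \<open>d (d y)\<close> vanishes, the expansion at \<open>y\<close> is
      linear: \<open>y\<close> equals \<open>y\<close> times the \<open>q\<close>-th power of
      \<open>d y\<close>.\<close>
    then have "d y [^] q = \<one>"
      using funpow_eq_displacement[OF h d_def yc, of q] hq[OF yc] ddy yc dc by simp
    moreover have "coprime p q"
      using p q False by (simp add: primes_coprime)
    ultimately show ?thesis
      using pow_coprime_eq_one[of "d y" p q] dy by (auto simp: p_torsion_def)
  next
    case True
    \<comment> \<open>Expanding at \<open>y\<close> itself would only repeat that \<open>d y\<close>
      has trivial \<open>p\<close>-th power. A \<open>p\<close>-th root \<open>x\<close> lies one
      layer higher and satisfies \<open>d x [^] p = d y\<close>, so the linear term at
      \<open>x\<close> is exactly the element to be killed.\<close>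
    obtain x where x: "x \<in> carrier G" "x [^] p = y"
      using div[OF yc] by blast
    have "x [^] (p ^ (n + 2)) = (x [^] p) [^] (p ^ Suc n)"
      using x(1) by (simp add: nat_pow_pow)
    then have xt: "x \<in> p_torsion G (p ^ (n + 2))"
      using x y by (simp add: p_torsion_def)
    have dx: "d x \<in> p_torsion G (p ^ 2)"
      using d_tors[OF xt] .
    have dxp: "d x [^] p = d y"
      using d_pow x by metis
    have ddx_p: "d (d x) [^] p = \<one>"
      using d_pow[of "d x" p] dxp ddy dc x by simp
    then have ddx: "d (d x) \<in> p_torsion G (p ^ 1)"
      using dc x by (simp add: p_torsion_def)
    have dddx: "d (d (d x)) = \<one>"
      using fix_k[OF ddx] n by simp
    \<comment> \<open>For \<open>p = 2\<close> the exponent is 1, and the factor vanishes because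
      \<open>d x\<close> has exponent 4 and so lies in a fixed layer. For odd \<open>p\<close> the
      binomial coefficient is a multiple of \<open>p\<close>.\<close>
    have "d (d x) [^] (p choose 2) = \<one>"
    proof (cases "p = 2")
      case True
      then show ?thesis
        using fix_k[OF dx] n by simp
    next
      case False
      then have "2 < p"
        using prime_ge_2_nat[OF p] by simp
      then have "p dvd p choose 2"
        using p by (intro dvd_choose_prime) auto
      then show ?thesis
        using ddx_p dc x by (metis dvd_def nat_pow_pow nat_pow_one)
    qed
    then have "d x [^] p = \<one>"
      using funpow_eq_displacement[OF h d_def x(1) dddx, of p] hq[OF x(1)] True x(1) dc by simp
    then show ?thesis
      using dxp by simp
  qed
  then show ?thesis
    using d1 yc by simp
qed

text \<open>Strong induction on the exponent \<open>m\<close>. Write \<open>m = q * m'\<close> with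
  \<open>q\<close> prime: the iterate \<open>h ^^ m'\<close> still fixes the given layer and its
  \<open>q\<close>-th iterate is the identity, so it fixes all higher layers one after another.
  These exhaust the group, hence \<open>m'\<close> is a smaller exponent for the same
  \<open>h\<close>.\<close>

lemma (in comm_group) finite_order_hom_trivial:
  fixes p n m :: nat
  assumes h: "h \<in> hom G G" and p: "prime p"
    and p_group: "\<And>x. x \<in> carrier G \<Longrightarrow> \<exists>k::nat. x [^] (p ^ k) = \<one>"
    and div: "\<And>x. x \<in> carrier G \<Longrightarrow> \<exists>y\<in>carrier G. y [^] p = x"
    and n: "1 \<le> n" "p = 2 \<Longrightarrow> 2 \<le> n"
    and fix_n: "\<And>x. x \<in> p_torsion G (p ^ n) \<Longrightarrow> h x = x"
    and "0 < m" and "\<And>x. x \<in> carrier G \<Longrightarrow> (h ^^ m) x = x"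
    and "x \<in> carrier G"
  shows "h x = x"
  using \<open>0 < m\<close> h fix_n assms(9-)
proof (induction m arbitrary: h x rule: less_induct)
  case (less m)
  show ?case
  proof (cases "m = 1")
    case True
    then show ?thesis using less.prems by simp
  next
    case False
    then obtain q m' where q: "prime q" "m = q * m'"
      using prime_factor_nat[of m] by blast
    interpret h: group_hom G G h
      using less.prems(2) by unfold_locales
    have hm_closed: "(h ^^ k) x \<in> carrier G" if "x \<in> carrier G" for k x
      using that by (induction k) auto
    have hm_hom: "h ^^ m' \<in> hom G G"
    proof (rule homI)
      show "(h ^^ m') (x \<otimes> y) = (h ^^ m') x \<otimes> (h ^^ m') y"
        if "x \<in> carrier G" "y \<in> carrier G" for x y
        using that by (induction m') (auto simp: hm_closed)
    qed (rule hm_closed)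
    have hm_fix: "(h ^^ m') x = x" if "x \<in> p_torsion G (p ^ n)" for x
      using less.prems(3)[OF that] by (induction m') auto
    have hm_q: "((h ^^ m') ^^ q) x = x" if "x \<in> carrier G" for x
      using less.prems(4)[OF that] q by (simp add: funpow_mult mult.commute)
    have hm_fix': "x \<in> p_torsion G (p ^ (n + k)) \<Longrightarrow> (h ^^ m') x = x" for x k
    proof (induction k arbitrary: x)
      case 0
      then show ?case using hm_fix by simp
    next
      case (Suc k)
      then show ?case
        using hom_fixes_p_torsion_Suc[OF hm_hom p q(1) div hm_q, of "n + k" x] n
        by (simp add: trans_le_add1)
    qed
    have "(h ^^ m') x = x" if x: "x \<in> carrier G" for x
    proof -
      obtain k where "x \<in> p_torsion G (p ^ k)"
        using p_group[OF x] x by (auto simp: p_torsion_def)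
      then show ?thesis
        using hm_fix' p_torsion_mono[of "p ^ k" "p ^ (n + k)"] by (auto simp: le_imp_power_dvd)
    qed
    moreover have "m' < m" "0 < m'"
      using q less.prems(1) prime_gt_1_nat[OF q(1)] by auto
    ultimately show ?thesis
      using less.IH[of m' h x] less.prems by blast
  qed
qed

text \<open>The displacement of \<open>y\<close> is killed by \<open>p\<close>, hence lies in a
  layer that \<open>h\<close> fixes. The expansion of the \<open>p\<close>-th iterate at
  \<open>y\<close> therefore stops at the factor \<open>d y [^] p\<close>, which is trivial.\<close>

lemma (in comm_group) funpow_fixes_p_torsion_Suc:
  fixes p n :: nat
  assumes h: "h \<in> hom G G" and n: "1 \<le> n"
    and fix_n: "\<And>x. x \<in> p_torsion G (p ^ n) \<Longrightarrow> h x = x"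
    and y: "y \<in> p_torsion G (p ^ Suc n)"
  shows "(h ^^ p) y = y"
proof -
  interpret h: group_hom G G h
    using h by unfold_locales
  define d where "d = (\<lambda>y. h y \<otimes> inv y)"
  have yc: "y \<in> carrier G" and "(y [^] p) [^] (p ^ n) = \<one>"
    using y by (auto simp: p_torsion_def nat_pow_pow)
  then have "h (y [^] p) = y [^] p"
    by (intro fix_n) (simp add: p_torsion_def)
  then have dyp: "d y [^] p = \<one>"
    using yc by (simp add: d_def h.hom_nat_pow nat_pow_distrib nat_pow_inv)
  have dyc: "d y \<in> carrier G"
    using yc by (simp add: d_def)
  have "d y \<in> p_torsion G (p ^ n)"
    using p_torsion_mono[of p "p ^ n"] dyp dyc n by (auto simp: p_torsion_def dvd_power)
  then have "d (d y) = \<one>"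
    using fix_n dyc by (simp add: d_def)
  moreover from this have "d (d (d y)) = \<one>"
    by (simp add: d_def)
  ultimately show ?thesis
    using funpow_eq_displacement[OF h d_def yc, of p] dyp yc by simp
qed

section \<open>Groups of exponent two and actions by conjugation\<close>

lemma (in group) comm_groupI_exponent_two:
  assumes "\<And>x. x \<in> carrier G \<Longrightarrow> x \<otimes> x = \<one>"
  shows "comm_group G"
proof (rule group_comm_groupI)
  have inv: "inv x = x" if "x \<in> carrier G" for x
    using assms that by (intro inv_equality)
  show "x \<otimes> y = y \<otimes> x" if "x \<in> carrier G" "y \<in> carrier G" for x y
    using inv[of "x \<otimes> y"] inv[of x] inv[of y] inv_mult_group[of x y] that by simp
qed

lemma (in group) group_action_conj_action:
  assumes H: "subgroup H G" and X: "X \<subseteq> carrier G"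
    and closed: "\<And>h x. h \<in> H \<Longrightarrow> x \<in> X \<Longrightarrow> h \<otimes> x \<otimes> inv h \<in> X"
  shows "group_action (G\<lparr>carrier := H\<rparr>) X (conj_action G X)"
proof -
  interpret H: subgroup H G by (fact H)
  have conj_mult: "(g \<otimes> h) \<otimes> x \<otimes> inv (g \<otimes> h) = g \<otimes> (h \<otimes> x \<otimes> inv h) \<otimes> inv g"
    if "g \<in> H" "h \<in> H" "x \<in> X" for g h x
    using that X by (simp add: inv_mult_group m_assoc subset_iff)
  have cancel: "g \<otimes> (inv g \<otimes> x \<otimes> g) \<otimes> inv g = x" "inv g \<otimes> (g \<otimes> x \<otimes> inv g) \<otimes> g = x"
    if "g \<in> H" "x \<in> X" for g x
  proof -
    have c: "g \<in> carrier G" "x \<in> carrier G" using that X by auto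
    show "g \<otimes> (inv g \<otimes> x \<otimes> g) \<otimes> inv g = x" "inv g \<otimes> (g \<otimes> x \<otimes> inv g) \<otimes> g = x"
      using c by (simp_all add: m_assoc) (simp_all add: m_assoc[symmetric])
  qed
  \<comment> \<open>Closure under conjugation by inverses makes conjugation by \<open>inv g\<close>
    a two-sided inverse inside \<open>X\<close>, so the action is by bijections of
    \<open>X\<close>.\<close>
  have closed': "inv g \<otimes> x \<otimes> g \<in> X" if "g \<in> H" "x \<in> X" for g x
    using closed[of "inv g" x] that by simp
  have bij: "conj_action G X g \<in> Bij X" if "g \<in> H" for g
  proof -
    have "bij_betw (conj_action G X g) X X"
      by (rule bij_betw_byWitness[where f' = "\<lambda>x. inv g \<otimes> x \<otimes> g"])
        (use that closed closed' cancel in \<open>auto simp: conj_action_def\<close>)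
    then show ?thesis
      by (simp add: Bij_def conj_action_def)
  qed
  have "conj_action G X \<in> hom (G\<lparr>carrier := H\<rparr>) (BijGroup X)"
  proof (rule homI)
    show "conj_action G X (g \<otimes>\<^bsub>G\<lparr>carrier := H\<rparr>\<^esub> h)
        = conj_action G X g \<otimes>\<^bsub>BijGroup X\<^esub> conj_action G X h"
      if "g \<in> carrier (G\<lparr>carrier := H\<rparr>)" "h \<in> carrier (G\<lparr>carrier := H\<rparr>)" for g h
      using that bij closed conj_mult
      by (auto simp: BijGroup_def compose_def fun_eq_iff) (auto simp: conj_action_def)
  qed (use bij in \<open>simp add: BijGroup_def\<close>)
  then show ?thesis
    using group_BijGroup H.subgroup_is_group[OF is_group]
    by (simp add: group_action_def group_hom_def group_hom_axioms_def)
qed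

section \<open>The Pruefer group and the \<open>p\<close>-torsion as a vector space\<close>

lemma group_pruefer_group:
  assumes "0 < p"
  shows "group (pruefer_group p)"
proof (rule groupI)
  show "x \<otimes>\<^bsub>pruefer_group p\<^esub> y \<in> carrier (pruefer_group p)"
    if xy: "x \<in> carrier (pruefer_group p)" "y \<in> carrier (pruefer_group p)" for x y
  proof -
    obtain m n where mn: "x ^ (p ^ m) = 1" "y ^ (p ^ n) = 1"
      using xy by (auto simp: pruefer_group_def)
    have "x ^ (p ^ (m + n)) = (x ^ (p ^ m)) ^ (p ^ n)" "y ^ (p ^ (m + n)) = (y ^ (p ^ n)) ^ (p ^ m)"
      by (simp_all add: power_add mult.commute flip: power_mult)
    then have "(x * y) ^ (p ^ (m + n)) = 1"
      using mn by (simp add: power_mult_distrib)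
    then show ?thesis
      by (auto simp: pruefer_group_def)
  qed
  show "\<exists>y\<in>carrier (pruefer_group p). y \<otimes>\<^bsub>pruefer_group p\<^esub> x = \<one>\<^bsub>pruefer_group p\<^esub>"
    if "x \<in> carrier (pruefer_group p)" for x
  proof (rule bexI)
    \<comment> \<open>Positivity of \<open>p\<close> matters here: for \<open>p = 0\<close> the
      equation \<open>0 ^ (0 ^ 1) = 1\<close> would put 0 into the carrier.\<close>
    have "x \<noteq> 0"
      using that assms by (auto simp: pruefer_group_def power_0_left split: if_splits)
    then show "inverse x \<otimes>\<^bsub>pruefer_group p\<^esub> x = \<one>\<^bsub>pruefer_group p\<^esub>"
      by (simp add: pruefer_group_def)
    show "inverse x \<in> carrier (pruefer_group p)"
      using that by (auto simp: pruefer_group_def power_inverse)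
  qed
qed (auto simp: pruefer_group_def intro: exI[of _ 0])

text \<open>The scalars are representatives in \<open>{0..<p}\<close> whose sums and products are
  reduced modulo \<open>p\<close>; the module laws hold because this reduction does not change
  powers of torsion elements.\<close>

lemma (in group) int_pow_mod_p_torsion:
  assumes "x \<in> p_torsion G p"
  shows "x [^] (k mod int p) = x [^] k"
proof -
  have x: "x \<in> carrier G" "x [^] int p = \<one>"
    using assms by (auto simp: p_torsion_def int_pow_int)
  have "x [^] k = x [^] (int p * (k div int p) + k mod int p)"
    by simp
  also have "\<dots> = x [^] (k mod int p)"
    using x by (simp only: int_pow_mult int_pow_pow[symmetric]) simp
  finally show ?thesis by simp
qed

lemma (in comm_group) subgroup_p_torsion: "subgroup (p_torsion G n) G"
  by (rule subgroupI) (auto simp: p_torsion_def nat_pow_distrib nat_pow_inv)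

lemma (in comm_group) module_p_torsion:
  assumes "1 < p"
  shows "module (residue_ring (int p)) (p_torsion_module G p)"
proof -
  interpret R: residues "int p" "residue_ring (int p)"
    using assms by unfold_locales simp_all
  interpret T: subgroup "p_torsion G p" G
    by (rule subgroup_p_torsion)
  note V = p_torsion_module_def
  have pow_closed: "x [^] k \<in> p_torsion G p" if "x \<in> p_torsion G p" for x and k :: int
    using that T.subset by (auto simp: subgroup_int_pow_closed subgroup_p_torsion)
  show ?thesis
  proof (rule moduleI)
    show "abelian_group (p_torsion_module G p)"
    proof (rule abelian_groupI)
      show "\<exists>y\<in>carrier (p_torsion_module G p). y \<oplus>\<^bsub>p_torsion_module G p\<^esub> x = \<zero>\<^bsub>p_torsion_module G p\<^esub>"
        if "x \<in> carrier (p_torsion_module G p)" for x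
        using that by (intro bexI[of _ "inv x"]) (auto simp: V)
    qed (auto simp: V m_ac)
  qed (auto simp: V R.cring R.res_carrier_eq R.res_add_eq R.res_mult_eq R.res_one_eq pow_closed
        int_pow_mod_p_torsion int_pow_mult int_pow_distrib int_pow_pow mult.commute)
qed

text \<open>The isomorphism turns the \<open>p\<close>-torsion into \<open>r\<close>-tuples of
  \<open>p\<close>-th roots of unity, all of them powers of one primitive root. Preimages of the
  tuples with that root in one place and 1 elsewhere form a basis.\<close>

lemma (in comm_group) has_dimension_p_torsion:
  assumes p: "prime p" and iso: "G \<cong> sum_group {..<r} (\<lambda>_. pruefer_group p)"
  shows "has_dimension (residue_ring (int p)) (p_torsion_module G p) r"
proof -
  define V where "V = p_torsion_module G p"
  define R where "R = residue_ring (int p)"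
  have p1: "1 < p" using p by (rule prime_gt_1_nat)
  interpret V: module R V
    unfolding V_def R_def by (rule module_p_torsion) fact
  have carrier_V: "carrier V = p_torsion G p" and add_V: "x \<oplus>\<^bsub>V\<^esub> y = x \<otimes> y" 
    and zero_V: "\<zero>\<^bsub>V\<^esub> = \<one>" and smult_V: "k \<odot>\<^bsub>V\<^esub> x = x [^] k" for x y k
    by (simp_all add: V_def p_torsion_module_def)
  have carrier_R: "carrier R = {0..<int p}"
    by (auto simp: R_def residue_ring_def)
  define S where "S = sum_group {..<r} (\<lambda>_. pruefer_group p)"
  \<comment> \<open>The index set is finite, so the direct sum is the full product.\<close>
  have carrier_S: "carrier S = ({..<r} \<rightarrow>\<^sub>E carrier (pruefer_group p))"
    using p1 by (simp add: S_def carrier_sum_group group_pruefer_group)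
  obtain f where f: "f \<in> iso G S"
    using iso by (auto simp: is_iso_def S_def)
  have bij: "bij_betw f (carrier G) (carrier S)" and "f \<in> hom G S"
    using f by (auto simp: iso_def)
  have "group S"
    using p1 by (simp add: S_def group_pruefer_group)
  then interpret f: group_hom G S f
    using \<open>f \<in> hom G S\<close> by (simp add: group_hom_def group_hom_axioms_def is_group)
  have f_mult: "f (x \<otimes> y) j = f x j * f y j" if "x \<in> carrier G" "y \<in> carrier G" "j < r" for x y j
    using that f.hom_mult by (simp add: S_def pruefer_group_def)
  have f_one: "f \<one> j = 1" if "j < r" for j
    using that f.hom_one by (simp add: S_def pruefer_group_def)
  note f.hom_mult [simp del] f.hom_one [simp del]
  have f_pow: "f (x [^] k) j = f x j ^ k" if "x \<in> carrier G" "j < r" for x j and k :: nat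
    using that by (induction k) (simp_all add: f_one f_mult)
  have f_eqI: "x = y" if "x \<in> carrier G" "y \<in> carrier G" "\<And>j. j < r \<Longrightarrow> f x j = f y j" for x y
  proof -
    have "f x \<in> carrier S" "f y \<in> carrier S"
      using that by auto
    then have "f x = f y"
      unfolding carrier_S by (rule PiE_ext) (use that in auto)
    then show ?thesis
      using bij that by (auto simp: bij_betw_def inj_on_def)
  qed
  have f_finsum: "f (finsum V g A) j = (\<Prod>a\<in>A. f (g a) j)"
    if "finite A" "g \<in> A \<rightarrow> carrier V" "j < r" for g and A :: "'a set" and j
    using that
  proof (induction A rule: finite_induct)
    case empty
    then show ?case by (simp add: zero_V f_one)
  next
    case (insert a A)
    moreover have "finsum V g A \<in> carrier V"
      using insert by (intro V.M.finsum_closed) auto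
    ultimately show ?case
      by (auto simp: add_V f_mult carrier_V p_torsion_def Pi_iff)
  qed
  \<comment> \<open>A primitive \<open>p\<close>-th root of unity: its exponents below
    \<open>p\<close> enumerate the \<open>p\<close>-th roots without repetition and so match the
    scalars.\<close>
  define \<zeta> where "\<zeta> = cis (2 * pi / real p)"
  have roots: "bij_betw (\<lambda>k. \<zeta> ^ k) {..<p} {z. z ^ p = 1}"
    using bij_betw_roots_unity[of p] p1 by (simp add: \<zeta>_def DeMoivre field_simps)
  have root_inj: "k = l" if "\<zeta> ^ k = \<zeta> ^ l" "k < p" "l < p" for k l
    using roots that by (auto simp: bij_betw_def inj_on_def)
  have root_pow: "(\<zeta> ^ k) ^ p = 1" for k
  proof -
    have "\<zeta> ^ p = 1"
      using roots p1 by (auto simp: bij_betw_def image_def set_eq_iff dest!: spec[of _ "\<zeta>"] intro!: bexI[of _ 1])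
    then show ?thesis
      by (metis mult.commute power_mult power_one)
  qed
  have realise: "\<exists>x\<in>p_torsion G p. \<forall>j<r. f x j = \<zeta> ^ k j" for k
  proof -
    define y where "y = (\<lambda>j\<in>{..<r}. \<zeta> ^ k j)"
    have "y \<in> carrier S"
      using root_pow by (auto simp: carrier_S y_def pruefer_group_def intro!: exI[of _ 1])
    then have "y \<in> f ` carrier G"
      by (simp only: bij_betw_imp_surj_on[OF bij])
    then obtain x where x: "x \<in> carrier G" "f x = y"
      by blast
    have fx: "f x j = \<zeta> ^ k j" if "j < r" for j
      using that by (simp add: x(2) y_def)
    have "x [^] p = \<one>"
      by (rule f_eqI) (simp_all add: x(1) f_pow f_one fx root_pow)
    then show ?thesis
      using fx x(1) by (intro bexI[of _ x]) (simp_all add: p_torsion_def)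
  qed
  have "\<forall>i. \<exists>x. x \<in> p_torsion G p \<and> (\<forall>j<r. f x j = \<zeta> ^ (if j = i then 1 else 0))"
    using realise[of "\<lambda>j. if j = i then 1 else 0" for i] by blast
  \<comment> \<open>These are the preimages of the unit vectors; for \<open>i \<ge> r\<close> all
    coordinates of \<open>f (b i)\<close> are 1.\<close>
  from choice[OF this] obtain b where "\<forall>i. b i \<in> p_torsion G p \<and> (\<forall>j<r. f (b i) j = \<zeta> ^ (if j = i then 1 else 0))"
    by (elim exE)
  then have b: "b i \<in> p_torsion G p" "j < r \<Longrightarrow> f (b i) j = \<zeta> ^ (if j = i then 1 else 0)" for i j
    by simp_all
  have inj: "inj_on b {..<r}"
  proof (rule inj_onI)
    fix i j assume ij: "i \<in> {..<r}" "j \<in> {..<r}" "b i = b j"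
    show "i = j"
    proof (rule ccontr)
      assume "i \<noteq> j"
      then have "\<zeta> ^ 0 = f (b i) j"
        using b(2)[of j i] ij(2) by simp
      also have "\<dots> = \<zeta> ^ 1"
        using b(2)[of j j] ij(2) by (simp add: ij(3))
      finally show False
        using root_inj[of 0 1] p1 by simp
    qed
  qed
  define B where "B = b ` {..<r}"
  \<comment> \<open>Coordinate \<open>j\<close> of a linear combination sees only the coefficient of
    \<open>b j\<close>, as every other basis vector contributes a factor 1. This gives both
    existence and uniqueness of coefficients.\<close>
  have coord: "f (\<Oplus>\<^bsub>V\<^esub>s\<in>B. c s \<odot>\<^bsub>V\<^esub> s) j = \<zeta> ^ nat (c (b j))"
    if c: "c \<in> B \<rightarrow>\<^sub>E carrier R" and j: "j < r" for c j
  proof -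
    have sV: "s \<in> carrier V" if "s \<in> B" for s
      using that b by (auto simp: B_def carrier_V)
    have cR: "c s \<in> carrier R" if "s \<in> B" for s
      using that c by auto
    have "f (\<Oplus>\<^bsub>V\<^esub>s\<in>B. c s \<odot>\<^bsub>V\<^esub> s) j = (\<Prod>s\<in>B. f (c s \<odot>\<^bsub>V\<^esub> s) j)"
      using j sV cR by (intro f_finsum) (auto simp: B_def)
    also have "\<dots> = (\<Prod>s\<in>B. f s j ^ nat (c s))"
    proof (rule prod.cong[OF refl])
      fix s assume "s \<in> B"
      then have s: "s \<in> carrier G" "0 \<le> c s"
        using sV[of s] cR[of s] by (simp_all add: carrier_R carrier_V p_torsion_def)
      then have "c s \<odot>\<^bsub>V\<^esub> s = s [^] nat (c s)"
        by (simp add: smult_V)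
      then show "f (c s \<odot>\<^bsub>V\<^esub> s) j = f s j ^ nat (c s)"
        using f_pow[OF s(1) j, of "nat (c s)"] by (simp only:)
    qed
    also have "\<dots> = (\<Prod>i<r. f (b i) j ^ nat (c (b i)))"
      unfolding B_def using inj by (simp add: prod.reindex)
    also have "\<dots> = (\<Prod>i<r. if j = i then \<zeta> ^ nat (c (b i)) else 1)"
      using j by (intro prod.cong) (auto simp: b)
    also have "\<dots> = \<zeta> ^ nat (c (b j))"
      using j by (simp add: prod.delta')
    finally show ?thesis .
  qed
  have "module_basis R V B"
    unfolding module_basis_def
  proof (intro conjI ballI)
    show "B \<subseteq> carrier V" "finite B"
      using b by (auto simp: B_def carrier_V)
    fix v assume v: "v \<in> carrier V"
    then have vG: "v \<in> carrier G" "v [^] p = \<one>"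
      by (auto simp: carrier_V p_torsion_def)
    have "\<exists>k<p. f v j = \<zeta> ^ k" if "j < r" for j
    proof -
      have "f v j ^ p = 1"
        using f_pow[OF vG(1) that, of p] f_one[OF that] vG(2) by simp
      then show ?thesis
        using roots by (auto simp: bij_betw_def image_def set_eq_iff)
    qed
    then have "\<forall>j\<in>{..<r}. \<exists>k. k < p \<and> f v j = \<zeta> ^ k"
      by blast
    from bchoice[OF this] obtain k where "\<forall>j\<in>{..<r}. k j < p \<and> f v j = \<zeta> ^ k j"
      by (elim exE)
    then have k: "k j < p" "f v j = \<zeta> ^ k j" if "j < r" for j
      using that by simp_all
    \<comment> \<open>The coefficient at \<open>b j\<close> is the discrete logarithm of coordinate
      \<open>j\<close> of \<open>f v\<close> to the base \<zeta>.\<close>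
    define c where "c = (\<lambda>s\<in>B. int (k (inv_into {..<r} b s)))"
    have c: "c \<in> B \<rightarrow>\<^sub>E carrier R"
      using k(1) inj by (auto simp: c_def B_def carrier_R)
    have cb: "nat (c (b j)) = k j" if "j < r" for j
      using that inj by (simp add: c_def B_def)
    show "\<exists>!c. c \<in> B \<rightarrow>\<^sub>E carrier R \<and> v = (\<Oplus>\<^bsub>V\<^esub>s\<in>B. c s \<odot>\<^bsub>V\<^esub> s)"
    proof (rule ex1I[of _ c])
      have "(\<Oplus>\<^bsub>V\<^esub>s\<in>B. c s \<odot>\<^bsub>V\<^esub> s) \<in> carrier V"
        using c b by (intro V.M.finsum_closed) (auto simp: B_def carrier_V[symmetric])
      then have "v = (\<Oplus>\<^bsub>V\<^esub>s\<in>B. c s \<odot>\<^bsub>V\<^esub> s)"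
        using vG by (intro f_eqI) (auto simp: carrier_V p_torsion_def coord[OF c] cb k(2))
      then show "c \<in> B \<rightarrow>\<^sub>E carrier R \<and> v = (\<Oplus>\<^bsub>V\<^esub>s\<in>B. c s \<odot>\<^bsub>V\<^esub> s)"
        using c by simp
    next
      fix c' assume c': "c' \<in> B \<rightarrow>\<^sub>E carrier R \<and> v = (\<Oplus>\<^bsub>V\<^esub>s\<in>B. c' s \<odot>\<^bsub>V\<^esub> s)"
      show "c' = c"
      proof (rule PiE_ext)
        show "c' \<in> B \<rightarrow>\<^sub>E carrier R" "c \<in> B \<rightarrow>\<^sub>E carrier R"
          using c c' by auto
        fix s assume "s \<in> B"
        then obtain j where j: "j < r" "s = b j"
          by (auto simp: B_def)
        have "c' s \<in> carrier R" "c s \<in> carrier R"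
          using c c' \<open>s \<in> B\<close> by auto
        moreover have "\<zeta> ^ nat (c' s) = \<zeta> ^ nat (c s)"
          using coord[of c' j] c' j k(2) cb by simp
        ultimately show "c' s = c s"
          using root_inj[of "nat (c' s)" "nat (c s)"] by (simp add: carrier_R nat_less_iff eq_nat_nat_iff)
      qed
    qed
  qed
  moreover have "card B = r"
    by (simp add: B_def card_image inj)
  ultimately show ?thesis
    by (auto simp: has_dimension_def V_def R_def)
qed

section \<open>The stabiliser acting on \<open>M\<close> and on its \<open>p\<close>-torsion\<close>

theorem theorem4p6:
  fixes \<Omega> :: "'a set" and G M H K :: "('a \<Rightarrow> 'a) set"
    and V :: "(int, 'a \<Rightarrow> 'a) module"
    and p r :: nat and \<alpha> :: 'a
  assumes "infinite \<Omega>"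
    and "subgroup G (BijGroup \<Omega>)"
    and "\<And>N. N \<lhd> perm_group \<Omega> G \<Longrightarrow> infinite N \<Longrightarrow>
          transitive_action (perm_group \<Omega> N) \<Omega> (\<lambda>g. g)"
    and "prime p"
    and "M \<lhd> perm_group \<Omega> G"
    and "regular_action (perm_group \<Omega> M) \<Omega> (\<lambda>g. g)"
    and "divisible_abelian_p_group_of_rank p r (perm_group \<Omega> M)"
    and "\<alpha> \<in> \<Omega>"
    and H_def: "H = stabilizer (perm_group \<Omega> G) (\<lambda>g. g) \<alpha>"
    and "finite H"
    and "faithful_action (perm_group \<Omega> H) M (conj_action (BijGroup \<Omega>) M)"
    and V_def: "V = p_torsion_module (perm_group \<Omega> M) p"
    and K_def: "K = kernel (perm_group \<Omega> H) (BijGroup (carrier V))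
                      (conj_action (BijGroup \<Omega>) (carrier V))"
  shows "group_module (residue_ring (int p)) (perm_group \<Omega> H) V
            (conj_action (BijGroup \<Omega>) (carrier V))
       \<and> has_dimension (residue_ring (int p)) V r
       \<and> (p > 2 \<longrightarrow> faithful_action (perm_group \<Omega> H) (carrier V)
                        (conj_action (BijGroup \<Omega>) (carrier V)))
       \<and> (p = 2 \<longrightarrow> elementary_abelian 2 (perm_group \<Omega> K))"
proof -
  define B where "B = BijGroup \<Omega>"
  define \<phi> where "\<phi> = conj_action B M"
  define \<psi> where "\<psi> = conj_action B (carrier V)"
  define A where "A = B\<lparr>carrier := M\<rparr>"
  define PH where "PH = B\<lparr>carrier := H\<rparr>"
  interpret B: group B
    unfolding B_def by (rule group_BijGroup)
  have A: "comm_group A"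
    and A_p_group: "\<And>x. x \<in> carrier A \<Longrightarrow> \<exists>k::nat. x [^]\<^bsub>A\<^esub> (p ^ k) = \<one>\<^bsub>A\<^esub>"
    and A_div: "\<And>x. x \<in> carrier A \<Longrightarrow> \<exists>y\<in>carrier A. y [^]\<^bsub>A\<^esub> p = x"
    and A_iso: "A \<cong> sum_group {..<r} (\<lambda>_. pruefer_group p)"
    using \<open>divisible_abelian_p_group_of_rank p r (perm_group \<Omega> M)\<close> prime_gt_0_nat[OF \<open>prime p\<close>]
    by (auto simp: divisible_abelian_p_group_of_rank_def A_def B_def)
  interpret A: comm_group A by fact
  have GB: "G \<subseteq> carrier B"
    using \<open>subgroup G (BijGroup \<Omega>)\<close> by (simp add: B_def subgroup.subset)
  have "M \<subseteq> G"
    using normal_imp_subgroup[OF \<open>M \<lhd> perm_group \<Omega> G\<close>] subgroup.subset by fastforce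
  then have M: "subgroup M B"
    using B.group_incl_imp_subgroup[of M] GB A.group_axioms by (auto simp: A_def)
  have carrier_A [simp]: "carrier A = M"
    by (simp add: A_def)
  have carrier_PH [simp]: "carrier PH = H"
    by (simp add: PH_def)
  interpret \<phi>: faithful_action PH M \<phi>
    using \<open>faithful_action (perm_group \<Omega> H) M (conj_action (BijGroup \<Omega>) M)\<close>
    by (simp add: PH_def \<phi>_def B_def)
  interpret PH: group PH
    using \<phi>.group_hom by (rule group_hom.axioms)
  have "H \<subseteq> G"
    by (auto simp: H_def stabilizer_def)
  then have H: "subgroup H B"
    using B.group_incl_imp_subgroup[of H] GB PH.group_axioms by (auto simp: PH_def)
  have carrier_V: "carrier V = p_torsion A p"
    by (simp add: V_def p_torsion_module_def A_def B_def)
  have V_sub_M: "carrier V \<subseteq> M"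
    by (auto simp: carrier_V p_torsion_def)
  have \<phi>_eq: "\<phi> g x = g \<otimes>\<^bsub>B\<^esub> x \<otimes>\<^bsub>B\<^esub> inv\<^bsub>B\<^esub> g" if "x \<in> M" for g x
    using that by (simp add: \<phi>_def conj_action_def)
  have \<psi>_eq: "\<psi> g x = \<phi> g x" if "x \<in> carrier V" for g x
    using that V_sub_M by (auto simp: \<psi>_def conj_action_def \<phi>_eq)
  have MB: "x \<in> carrier B" if "x \<in> M" for x
    using that M by (rule subgroup.mem_carrier[rotated])
  have HB: "g \<in> carrier B" if "g \<in> H" for g
    using that H by (rule subgroup.mem_carrier[rotated])
  have \<phi>_hom: "\<phi> g \<in> hom A A" if "g \<in> H" for g
  proof (rule homI)
    show "\<phi> g x \<in> carrier A" if "x \<in> carrier A" for x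
      using \<phi>.element_image[of g x] that \<open>g \<in> H\<close> by simp
    show "\<phi> g (x \<otimes>\<^bsub>A\<^esub> y) = \<phi> g x \<otimes>\<^bsub>A\<^esub> \<phi> g y" if "x \<in> carrier A" "y \<in> carrier A" for x y
    proof -
      have "x \<otimes>\<^bsub>B\<^esub> y \<in> M"
        using that M by (simp add: subgroup.m_closed)
      moreover have "inv\<^bsub>B\<^esub> g \<otimes>\<^bsub>B\<^esub> (g \<otimes>\<^bsub>B\<^esub> z) = z" if "z \<in> carrier B" for z
        using that HB[OF \<open>g \<in> H\<close>] by (simp flip: B.m_assoc)
      ultimately show ?thesis
        using that MB HB[OF \<open>g \<in> H\<close>] by (simp add: \<phi>_eq A_def B.m_assoc)
    qed
  qed
  have \<phi>_group_hom: "group_hom A A (\<phi> g)" if "g \<in> H" for g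
    using \<phi>_hom[OF that] A.group_axioms by (simp add: group_hom_def group_hom_axioms_def)
  have \<phi>_one: "\<phi> \<one>\<^bsub>PH\<^esub> x = x" if "x \<in> M" for x
    using \<phi>.id_eq_one that by (metis restrict_apply')
  \<comment> \<open>Iterating the conjugation by \<open>g\<close> is conjugation by a power of
    \<open>g\<close>; hence the order of \<open>H\<close> is an exponent for every
    \<open>\<phi> g\<close>.\<close>
  have \<phi>_pow: "(\<phi> g ^^ n) x = \<phi> (g [^]\<^bsub>PH\<^esub> n) x" if "g \<in> H" "x \<in> M" for g x n
  proof (induction n)
    case 0
    then show ?case
      using \<phi>_one that by simp
  next
    case (Suc n)
    then show ?case
      using that \<phi>.composition_rule[of x g "g [^]\<^bsub>PH\<^esub> n"] PH.nat_pow_closed[of g n] PH.nat_pow_Suc2[of g n]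
      by simp
  qed
  have \<phi>_order: "(\<phi> g ^^ order PH) x = x" if "g \<in> H" "x \<in> M" for g x
    using \<phi>_pow[OF that, of "order PH"] \<phi>_one that PH.pow_order_eq_1[of g] by simp
  have order: "0 < order PH"
    using \<open>finite H\<close> PH.order_gt_0_iff_finite by simp
  have \<phi>_trivial: "g = \<one>\<^bsub>PH\<^esub>" if "g \<in> H" "\<And>x. x \<in> M \<Longrightarrow> \<phi> g x = x" for g
  proof -
    \<comment> \<open>Conjugation maps are extensional on \<open>M\<close>, so agreement on
      \<open>M\<close> is equality of maps and faithfulness applies.\<close>
    have "\<phi> g = \<phi> \<one>\<^bsub>PH\<^esub>"
    proof (rule extensionalityI[of _ M])
      show "\<phi> g x = \<phi> \<one>\<^bsub>PH\<^esub> x" if "x \<in> M" for x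
        using that \<phi>_one \<open>\<And>x. x \<in> M \<Longrightarrow> \<phi> g x = x\<close> by simp
    qed (simp_all add: \<phi>_def conj_action_def)
    then show ?thesis
      using inj_onD[OF \<phi>.faithful, of g "\<one>\<^bsub>PH\<^esub>"] PH.one_closed that(1) by simp
  qed
  have \<psi>_closed: "\<phi> g x \<in> carrier V" if "g \<in> H" "x \<in> carrier V" for g x
  proof -
    interpret g: group_hom A A "\<phi> g"
      using that by (intro \<phi>_group_hom)
    have x: "x \<in> carrier A" "x [^]\<^bsub>A\<^esub> p = \<one>\<^bsub>A\<^esub>"
      using that by (auto simp: carrier_V p_torsion_def)
    then have "\<phi> g x [^]\<^bsub>A\<^esub> p = \<one>\<^bsub>A\<^esub>"
      using g.hom_nat_pow[of x p] by (simp only: g.hom_one)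
    then show ?thesis
      using g.hom_closed[OF x(1)] by (simp add: carrier_V p_torsion_def)
  qed
  have \<psi>: "group_action PH (carrier V) \<psi>"
    unfolding PH_def \<psi>_def
  proof (rule B.group_action_conj_action[OF H])
    show "carrier V \<subseteq> carrier B"
      using V_sub_M MB by blast
    show "g \<otimes>\<^bsub>B\<^esub> x \<otimes>\<^bsub>B\<^esub> inv\<^bsub>B\<^esub> g \<in> carrier V" if "g \<in> H" "x \<in> carrier V" for g x
      using \<psi>_closed[OF that] V_sub_M that by (auto simp: \<phi>_eq)
  qed
  then interpret \<psi>: group_hom PH "BijGroup (carrier V)" \<psi>
    by (rule group_action.group_hom)
  have K: "K = kernel PH (BijGroup (carrier V)) \<psi>"
    by (simp add: K_def PH_def \<psi>_def B_def)
  have K_fix: "\<phi> g x = x" if "g \<in> K" "x \<in> p_torsion A p" for g x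
    using that \<psi>_eq[of x g] by (auto simp: K kernel_def BijGroup_def carrier_V)
  have K_H: "g \<in> H" if "g \<in> K" for g
    using that by (auto simp: K kernel_def)
  \<comment> \<open>Used with \<open>n = 1\<close> on \<open>K\<close> itself for odd
    \<open>p\<close>, and with \<open>n = 2\<close> on squares of elements of \<open>K\<close> for
    \<open>p = 2\<close>.\<close>
  have K_trivial: "g = \<one>\<^bsub>PH\<^esub>" if "g \<in> H" "1 \<le> n" "p = 2 \<Longrightarrow> 2 \<le> n"
    "\<And>x. x \<in> p_torsion A (p ^ n) \<Longrightarrow> \<phi> g x = x" for g n
    using A.finite_order_hom_trivial[OF \<phi>_hom[OF that(1)] \<open>prime p\<close> A_p_group A_div that(2,3,4) order]
      \<phi>_order that(1) by (intro \<phi>_trivial) auto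
  have "module (residue_ring (int p)) V"
    using A.module_p_torsion[of p] prime_gt_1_nat[OF \<open>prime p\<close>] by (simp add: V_def A_def B_def)
  moreover have "\<psi> g (x \<oplus>\<^bsub>V\<^esub> y) = \<psi> g x \<oplus>\<^bsub>V\<^esub> \<psi> g y"
    if "g \<in> H" "x \<in> carrier V" "y \<in> carrier V" for g x y
  proof -
    have add_V: "u \<oplus>\<^bsub>V\<^esub> v = u \<otimes>\<^bsub>A\<^esub> v" for u v
      by (simp add: V_def p_torsion_module_def A_def B_def)
    have "x \<otimes>\<^bsub>A\<^esub> y \<in> carrier V"
      using that subgroup.m_closed[OF A.subgroup_p_torsion] by (simp add: carrier_V)
    then show ?thesis
      using that subsetD[OF V_sub_M] hom_mult[OF \<phi>_hom[OF that(1)], of x y] by (simp add: add_V \<psi>_eq)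
  qed
  moreover have "\<psi> g (k \<odot>\<^bsub>V\<^esub> x) = k \<odot>\<^bsub>V\<^esub> \<psi> g x"
    if "g \<in> H" "x \<in> carrier V" for g x and k :: int
  proof -
    have smult_V: "k \<odot>\<^bsub>V\<^esub> u = u [^]\<^bsub>A\<^esub> k" for u
      by (simp add: V_def p_torsion_module_def A_def B_def)
    have "x [^]\<^bsub>A\<^esub> k \<in> carrier V"
      using that A.subgroup_int_pow_closed[OF A.subgroup_p_torsion] by (simp add: carrier_V)
    then show ?thesis
      using that subsetD[OF V_sub_M] group_hom.hom_int_pow[OF \<phi>_group_hom[OF that(1)], of x k]
      by (simp add: smult_V \<psi>_eq)
  qed
  ultimately have "group_module (residue_ring (int p)) PH V \<psi>"
    using \<psi> by (simp add: group_module_def)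
  moreover have "has_dimension (residue_ring (int p)) V r"
    using A.has_dimension_p_torsion[OF \<open>prime p\<close> A_iso] by (simp add: V_def A_def B_def)
  moreover have "faithful_action PH (carrier V) \<psi>" if "p > 2"
  proof -
    have "g = \<one>\<^bsub>PH\<^esub>" if "g \<in> K" for g
      using K_trivial[of g 1] K_fix K_H that \<open>p > 2\<close> by simp
    then have "K = {\<one>\<^bsub>PH\<^esub>}"
      using subgroup.one_closed[OF \<psi>.subgroup_kernel, folded K] by blast
    then show ?thesis
      using \<psi> \<psi>.inj_iff_trivial_ker by (simp add: faithful_action_def faithful_action_axioms_def K)
  qed
  moreover have "elementary_abelian 2 (B\<lparr>carrier := K\<rparr>)" if "p = 2"
  proof -
    have sq: "g \<otimes>\<^bsub>B\<^esub> g = \<one>\<^bsub>B\<^esub>" if "g \<in> K" for g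
    proof -
      note g = K_H[OF that]
      \<comment> \<open>\<open>g\<close> fixes the first layer, so its square fixes the second,
        which is high enough for triviality at the prime 2.\<close>
      have "\<phi> (g [^]\<^bsub>PH\<^esub> p) x = x" if "x \<in> p_torsion A (p ^ 2)" for x
        using A.funpow_fixes_p_torsion_Suc[OF \<phi>_hom[OF g], of 1 p x] K_fix[OF \<open>g \<in> K\<close>] that
          \<phi>_pow[OF g, of x p] by (simp add: numeral_2_eq_2) (simp add: p_torsion_def)
      then have "g [^]\<^bsub>PH\<^esub> p = \<one>\<^bsub>PH\<^esub>"
        using g PH.nat_pow_closed[of g p] by (intro K_trivial[of _ 2]) auto
      then show ?thesis
        using \<open>p = 2\<close> HB[OF g] by (simp add: numeral_2_eq_2 PH_def)
    qed
    have "group (PH\<lparr>carrier := K\<rparr>)"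
      unfolding K using \<psi>.subgroup_kernel by (intro PH.subgroup_imp_group)
    then interpret K: group "B\<lparr>carrier := K\<rparr>"
      by (simp add: PH_def)
    have "comm_group (B\<lparr>carrier := K\<rparr>)"
      using sq by (intro K.comm_groupI_exponent_two) simp
    then show ?thesis
      using sq K_H HB by (simp add: elementary_abelian_def numeral_2_eq_2)
  qed
  ultimately show ?thesis
    by (simp add: PH_def \<psi>_def B_def)
qed

end
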